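(* Let $F_1(n)$ be the power series coefficients defined by $$\sum_{n\geq 0} F_1(n) q^n=\sum_{k,n\geq 0} \frac{(q^{2n+2};q^2)_k}{(q^{2n+3};q^2)_k}\,q^{2k+3n+1}.$$ Then $\sum_{n\ge 0}F_1(n)q^n\succeq 0$, i.e. $F_1(n)\geq 0$ for every nonnegative integer $n$.
   Context: Notation: $q$ is a complex number with $|q|<1$; $(a;q)_0=1$, $(a;q)_n=\prod_{j=0}^{n-1}(1-aq^j)$ (and the same with $q$ replaced by $q^2$). The double sum runs over all nonnegative integers $k,n$. A power series $\sum_{n\ge0}a_nq^n$ is written $\succeq 0$ if $a_n\ge 0$ for all $n\ge 0$. *)

theory Defs
  imports "HOL-Complex_Analysis.Complex_Analysis" "HOL-Library.Nonpos_Ints"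
begin

definition qpoch :: "complex \<Rightarrow> complex \<Rightarrow> nat \<Rightarrow> complex" where
  "qpoch a q n = (\<Prod>j<n. 1 - a * q ^ j)"

(* The power series relation "is termwise nonnegative". The coefficients are complex;
   nonneg_Reals is the set of complex numbers that are real and nonnegative. *)
definition nonneg_series :: "(nat \<Rightarrow> complex) \<Rightarrow> bool" where
  "nonneg_series a \<longleftrightarrow> (\<forall>n. a n \<in> \<real>\<^sub>\<ge>\<^sub>0)"

end

theory Submission
  imports Defs
begin

text \<open>
The double sum has a closed form. Write \<open>(a;q)\<^sub>n\<close> for \<open>qpoch a q n\<close> and
\<open>\<psi>(q) = \<Sum>\<^sub>a q^(a(a+1)/2)\<close>. Put \<open>P\<^sub>N = (q^2;q^2)\<^sub>N / (q;q^2)\<^sub>N\<close> and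
\<open>e\<^sub>n = (q^3;q^2)\<^sub>n / (q^2;q^2)\<^sub>n\<close>. The \<open>(k,n)\<close>-th summand equals
\<open>e\<^sub>n q^n (P\<^sub>n\<^sub>+\<^sub>k\<^sub>+\<^sub>1 - P\<^sub>n\<^sub>+\<^sub>k)\<close>, so the sum over \<open>k\<close> telescopes to
\<open>e\<^sub>n q^n (P - P\<^sub>n)\<close> with \<open>P = lim P\<^sub>N\<close>. Three facts finish the evaluation: \<open>P = \<psi>(q)\<close>,
an identity of Gauss, obtained here from a finite identity of Shanks; \<open>\<Sum>\<^sub>n e\<^sub>n q^n = \<psi>(q)/(1-q^2)\<close>,
an instance of the \<open>q\<close>-binomial theorem; and \<open>e\<^sub>n P\<^sub>n = (1-q^(2n+1))/(1-q)\<close>. The result is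
\<open>\<psi>(q)^2/(1-q^2) - (1+q^2)/((1-q)(1-q^3))\<close> (theorem \<open>double_sum_eq\<close>).

In this form the \<open>n\<close>-th coefficient is visible: it is \<open>A(n) - (\<lfloor>2n/3\<rfloor> + 1)\<close>, where \<open>A(n)\<close> counts the
pairs of triangular numbers whose sum is at most \<open>n\<close> and has the parity of \<open>n\<close>. By Gauss's circle
argument \<open>A(n)\<close> is about \<open>\<pi>n/4\<close>, and \<open>\<pi>/4 > 2/3\<close>; positivity is therefore a lattice point estimate
with an explicit error term.

For the estimate, the substitution \<open>a = u + v\<close>, \<open>b = u - v\<close> (over the integers) turns the sum of two triangular numbers into
\<open>u(u+1) + v^2\<close>, whose parity is that of \<open>v\<close>. Slicing along \<open>v\<close>, the slice at \<open>v\<close> contains at least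
\<open>sqrt (n - v^2) - 1/2\<close> points. The polynomial minorant \<open>1 - t/2 - t^2/2\<close> of \<open>sqrt (1 - t)\<close> makes the
sum over the slices explicit; its leading term \<open>11n/15\<close> still exceeds \<open>2n/3\<close>, and it wins against
the error term once \<open>n \<ge> 100\<close>. The cases \<open>n < 100\<close> are settled by direct evaluation of the slices.
\<close>

section \<open>The q-shifted factorial and the q-binomial theorem\<close>

lemma qpoch_0 [simp]: "qpoch a q 0 = 1"
  by (simp add: qpoch_def)

lemma qpoch_Suc: "qpoch a q (Suc n) = qpoch a q n * (1 - a * q ^ n)"
  by (simp add: qpoch_def)

lemma qpoch_Suc_shift: "qpoch a q (Suc n) = (1 - a) * qpoch (a * q) q n"
  by (simp add: qpoch_def prod.lessThan_Suc_shift mult.assoc del: prod.lessThan_Suc)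

lemma qpoch_add: "qpoch a q (m + n) = qpoch a q m * qpoch (a * q ^ m) q n"
  by (induction n) (simp_all add: qpoch_Suc power_add mult_ac)

lemma one_minus_nonzero:
  fixes x :: complex
  assumes "norm x < 1"
  shows "1 - x \<noteq> 0"
  using assms by auto

lemma norm_mult_power_less_1:
  fixes a q :: complex
  assumes "norm q < 1" "norm a < 1"
  shows "norm (a * q ^ n) < 1"
proof -
  have "norm (a * q ^ n) \<le> norm a * 1"
    unfolding norm_mult norm_power using assms by (intro mult_left_mono power_le_one) auto
  then show ?thesis using assms by simp
qed

lemma norm_power_less_1:
  fixes q :: complex
  assumes "norm q < 1" "n > 0"
  shows "norm (q ^ n) < 1"
  using assms by (simp add: norm_power power_less_one_iff)

lemma one_minus_power_nonzero:
  fixes q :: complex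
  assumes "norm q < 1" "n > 0"
  shows "1 - q ^ n \<noteq> 0"
  using one_minus_nonzero[OF norm_power_less_1[OF assms]] .

lemma qpoch_nonzero:
  assumes "norm q < 1" "norm a < 1"
  shows "qpoch a q n \<noteq> 0"
  using norm_mult_power_less_1[OF assms] one_minus_nonzero
  by (auto simp: qpoch_def)

lemma convergent_prod_qpoch_factors:
  fixes a q :: complex
  assumes "norm q < 1"
  shows "convergent_prod (\<lambda>j. 1 - a * q ^ j)"
proof (intro abs_convergent_prod_imp_convergent_prod summable_imp_abs_convergent_prod)
  have "summable (\<lambda>j. norm a * norm q ^ j)"
    using assms by (intro summable_mult summable_geometric) auto
  then show "summable (\<lambda>j. norm (1 - a * q ^ j - 1))"
    by (simp add: norm_mult norm_power)
qed

lemma qpoch_LIMSEQ: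
  assumes "norm q < 1"
  shows "qpoch a q \<longlonglongrightarrow> prodinf (\<lambda>j. 1 - a * q ^ j)"
proof -
  have "(\<lambda>n. qpoch a q (Suc n)) \<longlonglongrightarrow> prodinf (\<lambda>j. 1 - a * q ^ j)"
    using convergent_prod_LIMSEQ[OF convergent_prod_qpoch_factors[OF assms, of a]]
    by (simp add: qpoch_def lessThan_Suc_atMost)
  then show ?thesis by (rule LIMSEQ_imp_Suc)
qed

text \<open>A convergent infinite product without zero factors does not vanish, so the limit of the denominator
is harmless.\<close>

lemma qpoch_quotient_LIMSEQ:
  assumes "norm q < 1" "norm b < 1"
  shows "(\<lambda>n. qpoch a q n / qpoch b q n) \<longlonglongrightarrow>
    prodinf (\<lambda>j. 1 - a * q ^ j) / prodinf (\<lambda>j. 1 - b * q ^ j)"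
proof (intro tendsto_divide qpoch_LIMSEQ assms(1) prodinf_nonzero convergent_prod_qpoch_factors)
  show "1 - b * q ^ j \<noteq> 0" for j
    using norm_mult_power_less_1[OF assms] one_minus_nonzero by blast
qed

lemma qpoch_quotient_bounded:
  assumes "norm q < 1" "norm b < 1"
  obtains B where "B > 0" "\<And>n. norm (qpoch a q n / qpoch b q n) \<le> B"
  using convergent_imp_Bseq[OF convergentI[OF qpoch_quotient_LIMSEQ[OF assms, of a]]]
  by (auto simp: Bseq_def)

lemma summable_norm_bounded_power:
  fixes c :: "nat \<Rightarrow> complex" and z :: complex
  assumes "\<And>n. norm (c n) \<le> B" "norm z < 1"
  shows "summable (\<lambda>n. norm (c n * z ^ n))"
proof (rule summable_comparison_test')
  show "summable (\<lambda>n. B * norm z ^ n)"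
    using assms(2) by (intro summable_mult summable_geometric) auto
  show "norm (norm (c n * z ^ n)) \<le> B * norm z ^ n" for n
    using assms(1)[of n] by (simp add: norm_mult norm_power mult_right_mono)
qed

text \<open>The recurrence of the coefficients gives the functional equation
\<open>(1 - w) f(w) = (1 - a w) f(w q)\<close> for the series \<open>f\<close>. Iterating it from \<open>z\<close> splits off the
quotient on the left and pushes the argument to \<open>z q^N\<close>, and \<open>f\<close> is continuous at \<open>0\<close> with value \<open>1\<close>.\<close>

theorem q_binomial:
  assumes q: "norm q < 1" and z: "norm z < 1"
  shows "(\<lambda>N. qpoch (a * z) q N / qpoch z q N) \<longlonglongrightarrow>
    (\<Sum>n. qpoch a q n / qpoch q q n * z ^ n)"
proof -
  define c where "c n = qpoch a q n / qpoch q q n" for n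
  define f where "f w = (\<Sum>n. c n * w ^ n)" for w
  obtain B where B: "B > 0" "\<And>n. norm (c n) \<le> B"
    using qpoch_quotient_bounded[OF q q, of a] unfolding c_def by blast
  have sm: "summable (\<lambda>n. c n * w ^ n)" if "norm w < 1" for w
    using summable_norm_bounded_power[OF B(2) that] by (rule summable_norm_cancel)
  have c_Suc: "c (Suc n) * (1 - q ^ Suc n) = c n * (1 - a * q ^ n)" for n
  proof -
    have "1 - q ^ Suc n \<noteq> 0"
      using norm_mult_power_less_1[OF q q, of n] by (intro one_minus_nonzero) simp
    then show ?thesis by (simp add: c_def qpoch_Suc)
  qed
  have step: "(1 - w) * f w = (1 - a * w) * f (w * q)" if w: "norm w < 1" for w
  proof -
    have wq: "norm (w * q) < 1" using norm_mult_power_less_1[OF q w, of 1] by simp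
    have "(\<lambda>n. c (Suc n) * w ^ Suc n - c (Suc n) * (w * q) ^ Suc n) sums
      ((f w - c 0) - (f (w * q) - c 0))"
      using sm[OF w] sm[OF wq] unfolding f_def
      by (intro sums_diff) (subst sums_Suc_iff, simp add: summable_sums)+
    moreover have "(\<lambda>n. c (Suc n) * w ^ Suc n - c (Suc n) * (w * q) ^ Suc n)
      = (\<lambda>n. w * (c n * w ^ n) - a * w * (c n * (w * q) ^ n))"
    proof
      fix n
      have "c (Suc n) * w ^ Suc n - c (Suc n) * (w * q) ^ Suc n
        = c (Suc n) * (1 - q ^ Suc n) * w ^ Suc n"
        by (simp add: algebra_simps)
      also have "\<dots> = w * (c n * w ^ n) - a * w * (c n * (w * q) ^ n)"
        unfolding c_Suc by (simp add: algebra_simps)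
      finally show "c (Suc n) * w ^ Suc n - c (Suc n) * (w * q) ^ Suc n = \<dots>" .
    qed
    moreover have "(\<lambda>n. w * (c n * w ^ n) - a * w * (c n * (w * q) ^ n)) sums
      (w * f w - a * w * f (w * q))"
      using sm[OF w] sm[OF wq] unfolding f_def
      by (intro sums_diff sums_mult summable_sums)
    ultimately have "(f w - c 0) - (f (w * q) - c 0) = w * f w - a * w * f (w * q)"
      by (simp only: sums_unique2)
    then show ?thesis by algebra
  qed
  have iter: "f z = qpoch (a * z) q N / qpoch z q N * f (z * q ^ N)" for N
  proof (induction N)
    case (Suc N)
    have zN: "norm (z * q ^ N) < 1" by (rule norm_mult_power_less_1[OF q z])
    have "f (z * q ^ N) = (1 - a * (z * q ^ N)) * f (z * q ^ N * q) / (1 - z * q ^ N)"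
      using one_minus_nonzero[OF zN] by (subst step[OF zN, symmetric]) simp
    then have "f (z * q ^ N) = (1 - a * z * q ^ N) / (1 - z * q ^ N) * f (z * q ^ Suc N)"
      by (simp add: mult.assoc mult.commute[of q])
    with Suc.IH have "f z = qpoch (a * z) q N / qpoch z q N
      * ((1 - a * z * q ^ N) / (1 - z * q ^ N) * f (z * q ^ Suc N))"
      by simp
    then show ?case by (simp add: qpoch_Suc)
  qed simp
  have "(\<lambda>N. f (z * q ^ N)) \<longlonglongrightarrow> f 0"
  proof (rule isCont_tendsto_compose[where g = f])
    have "summable (\<lambda>n. c n * (of_real ((1::real) / 2)) ^ n)" by (rule sm) simp
    then show "isCont f 0"
      unfolding f_def by (rule isCont_powser) simp
    show "(\<lambda>N. z * q ^ N) \<longlonglongrightarrow> 0"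
      using LIMSEQ_power_zero[OF q] by (intro tendsto_mult_right_zero)
  qed
  moreover have "f 0 = 1" unfolding f_def powser_zero by (simp add: c_def)
  ultimately have "(\<lambda>N. qpoch (a * z) q N / qpoch z q N * f (z * q ^ N)) \<longlonglongrightarrow>
    prodinf (\<lambda>j. 1 - a * z * q ^ j) / prodinf (\<lambda>j. 1 - z * q ^ j) * 1"
    using qpoch_quotient_LIMSEQ[OF q z, of "a * z"] by (intro tendsto_mult) auto
  then have "f z = prodinf (\<lambda>j. 1 - a * z * q ^ j) / prodinf (\<lambda>j. 1 - z * q ^ j)"
    unfolding iter[symmetric] by (simp add: LIMSEQ_const_iff)
  then show ?thesis
    using qpoch_quotient_LIMSEQ[OF q z, of "a * z"] by (simp add: f_def c_def)
qed

section \<open>Gauss's product for the triangular numbers\<close>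

definition gauss_prod :: "complex \<Rightarrow> nat \<Rightarrow> complex" where
  "gauss_prod q n = qpoch (q\<^sup>2) (q\<^sup>2) n / qpoch q (q\<^sup>2) n"

definition tri :: "nat \<Rightarrow> nat" where
  "tri a = a * (a + 1) div 2"

lemma two_tri: "2 * tri a = a * (a + 1)"
  by (simp add: tri_def)

lemma le_tri: "a \<le> tri a"
  by (induction a) (auto simp: tri_def)

text \<open>One of Ramanujan's theta functions.\<close>

definition psi :: "complex \<Rightarrow> complex" where
  "psi q = (\<Sum>a. q ^ tri a)"

lemma gauss_prod_nonzero: "norm q < 1 \<Longrightarrow> gauss_prod q n \<noteq> 0"
  by (simp add: gauss_prod_def qpoch_nonzero norm_power_less_1)

lemma gauss_prod_0 [simp]: "gauss_prod q 0 = 1"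
  by (simp add: gauss_prod_def)

lemma gauss_prod_Suc:
  "gauss_prod q (Suc n) = gauss_prod q n * (1 - q ^ (2 * n + 2)) / (1 - q ^ (2 * n + 1))"
proof -
  have "q\<^sup>2 * (q\<^sup>2) ^ n = q ^ (2 * n + 2)" "q * (q\<^sup>2) ^ n = q ^ (2 * n + 1)"
    by (simp_all add: power_mult[symmetric] power_add[symmetric] mult.commute)
  then show ?thesis by (simp add: gauss_prod_def qpoch_Suc)
qed

text \<open>Induction on \<open>n\<close>. Passing from \<open>n\<close> to \<open>n + 1\<close> changes the \<open>s\<close>-th summand by a multiple of
\<open>h (s + 1) - h s\<close> for an explicit \<open>h\<close> with \<open>h 0 = 0\<close>; the telescoped sum and the new summand are the
two new powers of \<open>q\<close> on the right.\<close>

lemma shanks_identity: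
  assumes q: "norm q < 1"
  shows "(\<Sum>s<n. gauss_prod q n / gauss_prod q s * q ^ (s * (2 * n + 1)))
    = (\<Sum>a<2 * n. q ^ tri a)"
proof (induction n)
  case (Suc n)
  define h where "h s = q ^ (s * (2 * n + 1)) * (1 - q ^ (2 * s)) / gauss_prod q s" for s
  note nz = gauss_prod_nonzero[OF q] one_minus_power_nonzero[OF q]
  have h_Suc: "h (Suc s) = q ^ (s * (2 * n + 1)) * q ^ (2 * n + 1) * (1 - q ^ (2 * s + 1))
      / gauss_prod q s" for s
    using nz(1)[of s] nz(2)[of "2 * s + 2"] nz(2)[of "2 * s + 1"]
    by (simp add: h_def gauss_prod_Suc power_add)
  have tele: "gauss_prod q (Suc n) / gauss_prod q s * q ^ (s * (2 * Suc n + 1))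
      - gauss_prod q n / gauss_prod q s * q ^ (s * (2 * n + 1))
    = gauss_prod q n / (1 - q ^ (2 * n + 1)) * (h (Suc s) - h s)" for s
  proof -
    have "q ^ (s * (2 * Suc n + 1)) = q ^ (s * (2 * n + 1)) * q ^ (2 * s)"
      by (simp add: power_add[symmetric] algebra_simps)
    then show ?thesis
      unfolding h_Suc using nz(1)[of s] nz(2)[of "2 * n + 1"]
      by (simp add: h_def gauss_prod_Suc divide_simps) (simp add: algebra_simps power_add)
  qed
  have "(\<Sum>s<Suc n. gauss_prod q (Suc n) / gauss_prod q s * q ^ (s * (2 * Suc n + 1)))
      - (\<Sum>s<Suc n. gauss_prod q n / gauss_prod q s * q ^ (s * (2 * n + 1)))
    = gauss_prod q n / (1 - q ^ (2 * n + 1)) * (\<Sum>s<Suc n. h (Suc s) - h s)"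
    unfolding sum_subtractf[symmetric] sum_distrib_left tele ..
  also have "(\<Sum>s<Suc n. h (Suc s) - h s) = h (Suc n)"
    unfolding sum_lessThan_telescope by (simp add: h_def)
  also have "gauss_prod q n / (1 - q ^ (2 * n + 1)) * h (Suc n) = q ^ ((n + 1) * (2 * n + 1))"
  proof -
    have "gauss_prod q n / (1 - q ^ (2 * n + 1)) * h (Suc n)
      = q ^ (n * (2 * n + 1)) * q ^ (2 * n + 1)"
      unfolding h_Suc using nz(1)[of n] nz(2)[of "2 * n + 1"] by (simp del: power_Suc)
    then show ?thesis by (simp add: power_add[symmetric] algebra_simps)
  qed
  finally have "(\<Sum>s<Suc n. gauss_prod q (Suc n) / gauss_prod q s * q ^ (s * (2 * Suc n + 1)))
    = (\<Sum>s<Suc n. gauss_prod q n / gauss_prod q s * q ^ (s * (2 * n + 1)))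
      + q ^ ((n + 1) * (2 * n + 1))"
    by (simp only: diff_eq_eq add.commute)
  also have "(\<Sum>s<Suc n. gauss_prod q n / gauss_prod q s * q ^ (s * (2 * n + 1)))
    = (\<Sum>a<2 * n. q ^ tri a) + q ^ (n * (2 * n + 1))"
    using nz(1)[of n] Suc.IH by simp
  finally have "(\<Sum>s<Suc n. gauss_prod q (Suc n) / gauss_prod q s * q ^ (s * (2 * Suc n + 1)))
    = (\<Sum>a<2 * n. q ^ tri a) + q ^ (n * (2 * n + 1)) + q ^ ((n + 1) * (2 * n + 1))"
    .
  also have "q ^ (n * (2 * n + 1)) = q ^ tri (2 * n)"
    by (simp only: tri_def mult.assoc nonzero_mult_div_cancel_left)
  also have "q ^ ((n + 1) * (2 * n + 1)) = q ^ tri (Suc (2 * n))"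
  proof -
    have "Suc (2 * n) * (Suc (2 * n) + 1) = 2 * ((n + 1) * (2 * n + 1))" by simp
    then show ?thesis by (simp only: tri_def nonzero_mult_div_cancel_left)
  qed
  finally show ?case by simp
qed simp

lemma summable_norm_triangular_powers:
  fixes q :: complex
  assumes "norm q < 1"
  shows "summable (\<lambda>a. norm (q ^ tri a))"
proof (rule summable_comparison_test')
  show "summable (\<lambda>a. norm q ^ a)" using assms by (intro summable_geometric) auto
  fix a :: nat
  show "norm (norm (q ^ tri a)) \<le> norm q ^ a"
    using assms le_tri[of a] by (simp add: norm_power power_decreasing)
qed

text \<open>In Shanks's identity the summand with \<open>s = 0\<close> is the product itself. The other summands carry a factor
\<open>q^(s(2n+1))\<close> and together are of order \<open>q^n\<close>.\<close>

theorem gauss_identity: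
  assumes q: "norm q < 1"
  shows "gauss_prod q \<longlonglongrightarrow> psi q"
proof -
  have q2: "norm (q\<^sup>2) < 1" using q by (simp add: norm_power_less_1)
  obtain L where L: "gauss_prod q \<longlonglongrightarrow> L"
    unfolding gauss_prod_def using qpoch_quotient_LIMSEQ[OF q2 q] by blast
  obtain B where B: "B > 0" "\<And>n. norm (qpoch q (q\<^sup>2) n / qpoch (q\<^sup>2) (q\<^sup>2) n) \<le> B"
    using qpoch_quotient_bounded[OF q2 q2, of q] by blast
  \<comment> \<open>the summands with \<open>s \<ge> 1\<close> in the identity of Shanks, divided by the product\<close>
  define T where "T n = (\<Sum>s\<in>{1..<n}. q ^ (s * (2 * n + 1)) / gauss_prod q s)" for n
  have "T \<longlonglongrightarrow> 0"
  proof (rule Lim_null_comparison)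
    show "\<forall>\<^sub>F n in sequentially. norm (T n) \<le> norm q ^ n * (B * (1 / (1 - norm q)))"
    proof (intro always_eventually allI)
      fix n
      have "norm (T n) \<le> (\<Sum>s\<in>{1..<n}. norm q ^ n * (B * norm q ^ s))"
        unfolding T_def
      proof (rule sum_norm_le)
        fix s assume "s \<in> {1..<n}"
        then have "n + s \<le> s * (2 * n + 1)" by (cases s) auto
        then have "norm q ^ (s * (2 * n + 1)) \<le> norm q ^ (n + s)"
          using q by (intro power_decreasing) auto
        moreover have "norm (1 / gauss_prod q s) \<le> B"
          using B(2)[of s] by (simp add: gauss_prod_def)
        ultimately have "norm q ^ (s * (2 * n + 1)) * norm (1 / gauss_prod q s)
          \<le> norm q ^ (n + s) * B"
          by (intro mult_mono) auto
        then show "norm (q ^ (s * (2 * n + 1)) / gauss_prod q s) \<le> norm q ^ n * (B * norm q ^ s)"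
          unfolding norm_divide norm_power norm_one power_add by (simp add: mult_ac)
      qed
      also have "\<dots> = norm q ^ n * (B * (\<Sum>s\<in>{1..<n}. norm q ^ s))"
        by (simp add: sum_distrib_left)
      also have "(\<Sum>s\<in>{1..<n}. norm q ^ s) \<le> (\<Sum>s. norm q ^ s)"
        using q by (intro sum_le_suminf summable_geometric) auto
      also have "\<dots> = 1 / (1 - norm q)" using q by (intro suminf_geometric) auto
      finally show "norm (T n) \<le> norm q ^ n * (B * (1 / (1 - norm q)))"
        using B(1) by (simp add: mult_left_mono)
    qed
    show "(\<lambda>n. norm q ^ n * (B * (1 / (1 - norm q)))) \<longlonglongrightarrow> 0"
      using q by (intro tendsto_mult_left_zero LIMSEQ_power_zero) auto
  qed
  then have "(\<lambda>n. gauss_prod q n + gauss_prod q n * T n) \<longlonglongrightarrow> L + L * 0"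
    by (intro tendsto_add tendsto_mult L)
  moreover have "\<forall>\<^sub>F n in sequentially. gauss_prod q n + gauss_prod q n * T n
    = (\<Sum>a<2 * n. q ^ tri a)"
    using eventually_gt_at_top[of 0]
  proof eventually_elim
    case (elim n)
    have "(\<Sum>a<2 * n. q ^ tri a)
      = (\<Sum>s<n. gauss_prod q n / gauss_prod q s * q ^ (s * (2 * n + 1)))"
      by (rule shanks_identity[OF q, symmetric])
    also have "{..<n} = insert 0 {1..<n}" using elim by auto
    also have "(\<Sum>s\<in>\<dots>. gauss_prod q n / gauss_prod q s * q ^ (s * (2 * n + 1)))
      = gauss_prod q n + gauss_prod q n * T n"
      by (simp add: T_def sum_distrib_left)
    finally show ?case by simp
  qed
  ultimately have "(\<lambda>n. \<Sum>a<2 * n. q ^ tri a) \<longlonglongrightarrow> L"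
    by (simp add: tendsto_cong)
  moreover have "(\<lambda>n. \<Sum>a<2 * n. q ^ tri a) \<longlonglongrightarrow> psi q"
  proof -
    have "(\<lambda>n. \<Sum>a<n. q ^ tri a) \<longlonglongrightarrow> psi q"
      unfolding psi_def
      by (rule summable_LIMSEQ[OF summable_norm_cancel[OF summable_norm_triangular_powers[OF q]]])
    moreover have "strict_mono (\<lambda>n::nat. 2 * n)" by (simp add: strict_mono_def)
    ultimately show ?thesis
      by (drule_tac LIMSEQ_subseq_LIMSEQ) (auto simp: o_def)
  qed
  ultimately show ?thesis using L LIMSEQ_unique by blast
qed

section \<open>Closed form of the double sum\<close>

text \<open>Over the complex numbers unconditional summability is absolute summability, which makes the family of
products summable.\<close>

lemma has_sum_product_complex:
  fixes f :: "'a \<Rightarrow> complex" and g :: "'b \<Rightarrow> complex"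
  assumes f: "(f has_sum a) A" and g: "(g has_sum b) B"
  shows "((\<lambda>(x, y). f x * g y) has_sum a * b) (A \<times> B)"
proof (rule has_sum_SigmaI)
  show "((\<lambda>y. case (x, y) of (x, y) \<Rightarrow> f x * g y) has_sum f x * b) B" for x
    using has_sum_cmult_right[OF g] by simp
  show "((\<lambda>x. f x * b) has_sum a * b) A"
    by (rule has_sum_cmult_left[OF f])
  have nf: "(\<lambda>x. norm (f x)) summable_on A" and ng: "(\<lambda>y. norm (g y)) summable_on B"
    using f g by (auto simp: summable_on_iff_abs_summable_on_complex[symmetric] summable_on_def)
  have "(\<lambda>(x, y). norm (f x) * norm (g y)) summable_on A \<times> B"
  proof (rule summable_on_SigmaI)
    show "((\<lambda>y. case (x, y) of (x, y) \<Rightarrow> norm (f x) * norm (g y)) has_sum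
      norm (f x) * infsum (\<lambda>y. norm (g y)) B) B" for x
      using has_sum_cmult_right[OF has_sum_infsum[OF ng]] by simp
    show "(\<lambda>x. norm (f x) * infsum (\<lambda>y. norm (g y)) B) summable_on A"
      by (rule summable_on_cmult_left[OF nf])
  qed auto
  then have "(\<lambda>p. norm (case p of (x, y) \<Rightarrow> f x * g y)) summable_on A \<times> B"
    by (simp add: case_prod_unfold norm_mult)
  then show "(\<lambda>(x, y). f x * g y) summable_on A \<times> B"
    by (rule abs_summable_summable)
qed

definition odd_even_ratio :: "complex \<Rightarrow> nat \<Rightarrow> complex" where
  "odd_even_ratio q n = qpoch (q ^ 3) (q\<^sup>2) n / qpoch (q\<^sup>2) (q\<^sup>2) n"

lemma odd_even_ratio_times_gauss_prod:
  assumes q: "norm q < 1"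
  shows "odd_even_ratio q n * gauss_prod q n = (1 - q ^ (2 * n + 1)) / (1 - q)"
proof -
  have q2: "norm (q\<^sup>2) < 1" using q by (simp add: norm_power_less_1)
  have "(1 - q) * qpoch (q ^ 3) (q\<^sup>2) n = qpoch q (q\<^sup>2) (Suc n)"
    unfolding qpoch_Suc_shift by (simp add: eval_nat_numeral)
  also have "\<dots> = qpoch q (q\<^sup>2) n * (1 - q ^ (2 * n + 1))"
    by (simp add: qpoch_Suc power_mult[symmetric])
  finally have "qpoch (q ^ 3) (q\<^sup>2) n = qpoch q (q\<^sup>2) n * (1 - q ^ (2 * n + 1)) / (1 - q)"
    using one_minus_nonzero[OF q] by (simp add: nonzero_eq_divide_eq mult.commute)
  then show ?thesis
    using qpoch_nonzero[OF q2 q, of n] qpoch_nonzero[OF q2 q2, of n]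
    by (simp add: odd_even_ratio_def gauss_prod_def)
qed

text \<open>This is the \<open>q\<close>-binomial theorem with base \<open>q^2\<close>, \<open>a = q^3\<close> and \<open>z = q\<close>. The resulting product
\<open>(q^4;q^2)\<^sub>N / (q;q^2)\<^sub>N\<close> differs from the one of Gauss only by its first and last factors.\<close>

lemma sums_odd_even_ratio:
  assumes q: "norm q < 1"
  shows "(\<lambda>n. odd_even_ratio q n * q ^ n) sums (psi q / (1 - q\<^sup>2))"
proof -
  have q2: "norm (q\<^sup>2) < 1" using q by (simp add: norm_power_less_1)
  have "(\<lambda>N. qpoch (q ^ 3 * q) (q\<^sup>2) N / qpoch q (q\<^sup>2) N) \<longlonglongrightarrow> (\<Sum>n. odd_even_ratio q n * q ^ n)"
    using q_binomial[OF q2 q, of "q ^ 3"] by (simp add: odd_even_ratio_def)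
  moreover have "qpoch (q ^ 3 * q) (q\<^sup>2) N / qpoch q (q\<^sup>2) N
    = gauss_prod q N * (1 - q\<^sup>2 * (q\<^sup>2) ^ N) / (1 - q\<^sup>2)" for N
  proof -
    have "(1 - q\<^sup>2) * qpoch (q ^ 3 * q) (q\<^sup>2) N = qpoch (q\<^sup>2) (q\<^sup>2) (Suc N)"
      unfolding qpoch_Suc_shift by (simp add: eval_nat_numeral mult.assoc)
    also have "\<dots> = qpoch (q\<^sup>2) (q\<^sup>2) N * (1 - q\<^sup>2 * (q\<^sup>2) ^ N)"
      by (simp add: qpoch_Suc)
    finally have "qpoch (q\<^sup>2) (q\<^sup>2) N * (1 - q\<^sup>2 * (q\<^sup>2) ^ N)
      = (1 - q\<^sup>2) * qpoch (q ^ 3 * q) (q\<^sup>2) N" ..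
    then have "qpoch (q ^ 3 * q) (q\<^sup>2) N = qpoch (q\<^sup>2) (q\<^sup>2) N * (1 - q\<^sup>2 * (q\<^sup>2) ^ N) / (1 - q\<^sup>2)"
      by (simp only: nonzero_mult_div_cancel_left[OF one_minus_nonzero[OF q2]])
    then show ?thesis by (simp add: gauss_prod_def)
  qed
  moreover have "(\<lambda>N. gauss_prod q N * (1 - q\<^sup>2 * (q\<^sup>2) ^ N) / (1 - q\<^sup>2)) \<longlonglongrightarrow>
    psi q * (1 - q\<^sup>2 * 0) / (1 - q\<^sup>2)"
    by (intro tendsto_intros gauss_identity[OF q] LIMSEQ_power_zero[OF q2] one_minus_nonzero[OF q2])
  ultimately have "(\<Sum>n. odd_even_ratio q n * q ^ n) = psi q / (1 - q\<^sup>2)"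
    by (simp add: LIMSEQ_unique)
  moreover obtain B where B: "\<And>n. norm (odd_even_ratio q n) \<le> B"
    using qpoch_quotient_bounded[OF q2 q2, of "q ^ 3"] unfolding odd_even_ratio_def by blast
  have "summable (\<lambda>n. odd_even_ratio q n * q ^ n)"
    by (rule summable_norm_cancel[OF summable_norm_bounded_power[OF B q]])
  ultimately show ?thesis by (simp add: sums_iff)
qed

lemma qpoch_quotient_eq_ratio:
  assumes q: "norm q < 1"
  shows "qpoch (q ^ (2 * n + 2)) (q ^ 2) k / qpoch (q ^ (2 * n + 3)) (q ^ 2) k
    = odd_even_ratio q n / odd_even_ratio q (n + k)"
proof -
  have q2: "norm (q\<^sup>2) < 1" "norm (q ^ 3) < 1" using q by (simp_all add: norm_power_less_1)
  have "qpoch (q\<^sup>2) (q\<^sup>2) (n + k) = qpoch (q\<^sup>2) (q\<^sup>2) n * qpoch (q ^ (2 * n + 2)) (q\<^sup>2) k"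
    "qpoch (q ^ 3) (q\<^sup>2) (n + k) = qpoch (q ^ 3) (q\<^sup>2) n * qpoch (q ^ (2 * n + 3)) (q\<^sup>2) k"
    unfolding qpoch_add by (simp_all add: power_mult[symmetric] power_add[symmetric] add.commute)
  then show ?thesis
    using qpoch_nonzero[OF q2(1) q2(1), of n] qpoch_nonzero[OF q2(1) q2(2), of n]
    by (simp add: odd_even_ratio_def)
qed

text \<open>The numerator of \<open>P\<^sub>N\<^sub>+\<^sub>1 - P\<^sub>N\<close> contains
\<open>(1 - q^(2N+2)) - (1 - q^(2N+1)) = (1 - q) q^(2N+1)\<close>, the power of \<open>q\<close> that occurs in the summand
for \<open>N = n + k\<close>.\<close>

lemma summand_telescopes:
  assumes q: "norm q < 1"
  shows "odd_even_ratio q n / odd_even_ratio q (n + k) * q ^ (2 * k + 3 * n + 1)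
    = odd_even_ratio q n * q ^ n * (gauss_prod q (n + Suc k) - gauss_prod q (n + k))"
proof -
  define N where "N = n + k"
  have nz: "1 - q \<noteq> 0" "1 - q ^ (2 * N + 1) \<noteq> 0" "gauss_prod q N \<noteq> 0"
    using one_minus_nonzero[OF q] one_minus_power_nonzero[OF q, of "2 * N + 1"]
      gauss_prod_nonzero[OF q] by auto
  have "odd_even_ratio q N = (1 - q ^ (2 * N + 1)) / (1 - q) / gauss_prod q N"
    unfolding odd_even_ratio_times_gauss_prod[OF q, of N, symmetric] using nz(3) by simp
  then have "q ^ (2 * N + 1) / odd_even_ratio q N = gauss_prod q N * ((1 - q) * q ^ (2 * N + 1)) / (1 - q ^ (2 * N + 1))"
    by simp
  also have "(1 - q) * q ^ (2 * N + 1) = (1 - q ^ (2 * N + 2)) - (1 - q ^ (2 * N + 1))"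
    by (simp add: algebra_simps)
  also have "gauss_prod q N * \<dots> / (1 - q ^ (2 * N + 1)) = gauss_prod q (Suc N) - gauss_prod q N"
    unfolding gauss_prod_Suc
    by (simp only: right_diff_distrib[of _ "1 - q ^ (2 * N + 2)"] diff_divide_distrib
      nonzero_mult_div_cancel_right[OF nz(2)])
  finally have "q ^ (2 * N + 1) / odd_even_ratio q N = gauss_prod q (Suc N) - gauss_prod q N" .
  moreover have exponent: "q ^ (2 * k + 3 * n + 1) = q ^ n * q ^ (2 * N + 1)"
    unfolding power_add[symmetric] by (simp add: N_def algebra_simps)
  have "odd_even_ratio q n / odd_even_ratio q N * q ^ (2 * k + 3 * n + 1) = odd_even_ratio q n * q ^ n * (q ^ (2 * N + 1) / odd_even_ratio q N)"
    unfolding exponent by simp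
  ultimately show ?thesis by (simp add: N_def)
qed

text \<open>Since both \<open>odd_even_ratio q n\<close> and its reciprocal are bounded in \<open>n\<close>, the double series is dominated by
a product of geometric series. It may be summed over \<open>k\<close> first, where it telescopes.\<close>

theorem double_sum_eq:
  assumes q: "norm q < 1"
  shows "(\<Sum>\<^sub>\<infinity>(k, n)\<in>UNIV. qpoch (q ^ (2 * n + 2)) (q ^ 2) k / qpoch (q ^ (2 * n + 3)) (q ^ 2) k
      * q ^ (2 * k + 3 * n + 1))
    = (psi q)\<^sup>2 / (1 - q\<^sup>2) - (1 + q\<^sup>2) / ((1 - q) * (1 - q ^ 3))"
proof -
  have q2: "norm (q\<^sup>2) < 1" "norm (q ^ 3) < 1" using q by (simp_all add: norm_power_less_1)
  define t where "t n k = odd_even_ratio q n / odd_even_ratio q (n + k) * q ^ (2 * k + 3 * n + 1)" for n k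
  obtain B where B: "B > 0" "\<And>n. norm (odd_even_ratio q n) \<le> B"
    using qpoch_quotient_bounded[OF q2(1) q2(1), of "q ^ 3"] unfolding odd_even_ratio_def by blast
  obtain C where C: "C > 0" "\<And>n. norm (1 / odd_even_ratio q n) \<le> C"
    using qpoch_quotient_bounded[OF q2(1) q2(2), of "q\<^sup>2"] unfolding odd_even_ratio_def by auto
  have geom: "((\<lambda>n. q ^ n) has_sum 1 / (1 - q)) UNIV"
    using q by (intro norm_summable_imp_has_sum geometric_sums)
      (auto simp: norm_power intro: summable_geometric)
  have "(\<lambda>(n, k). q ^ n * q ^ k) summable_on UNIV \<times> UNIV"
    using has_sum_product_complex[OF geom geom] by (rule has_sum_imp_summable)
  then have "(\<lambda>p. of_real (B * C) * (case p of (n, k) \<Rightarrow> q ^ n * q ^ k)) summable_on UNIV \<times> UNIV"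
    by (rule summable_on_cmult_right)
  then have "(\<lambda>p. norm (of_real (B * C) * (case p of (n, k) \<Rightarrow> q ^ n * q ^ k))) summable_on UNIV \<times> UNIV"
    by (simp only: summable_on_iff_abs_summable_on_complex)
  then have "(\<lambda>p. norm (case p of (n, k) \<Rightarrow> t n k)) summable_on UNIV \<times> UNIV"
  proof (rule Infinite_Sum.abs_summable_on_comparison_test)
    fix p :: "nat \<times> nat"
    obtain n k where p: "p = (n, k)" by (cases p)
    have "norm (t n k) = norm (odd_even_ratio q n) * norm (1 / odd_even_ratio q (n + k)) * norm q ^ (2 * k + 3 * n + 1)"
      by (simp add: t_def norm_mult norm_divide norm_power)
    also have "\<dots> \<le> B * C * norm q ^ (n + k)"
      using B C q by (intro mult_mono power_decreasing) auto
    finally show "norm (case p of (n, k) \<Rightarrow> t n k)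
      \<le> norm (of_real (B * C) * (case p of (n, k) \<Rightarrow> q ^ n * q ^ k))"
      using B C by (simp add: p norm_mult norm_power power_add)
  qed
  then have summable: "(\<lambda>(n, k). t n k) summable_on UNIV \<times> UNIV"
    by (rule abs_summable_summable)
  have row: "infsum (t n) UNIV = psi q * (odd_even_ratio q n * q ^ n) - (q ^ n - q * (q ^ 3) ^ n) / (1 - q)" for n
  proof -
    have "(\<lambda>k. gauss_prod q (n + k)) \<longlonglongrightarrow> psi q"
      using LIMSEQ_ignore_initial_segment[OF gauss_identity[OF q], of n] by (simp add: add.commute)
    from telescope_sums[OF this]
    have "t n sums (odd_even_ratio q n * q ^ n * (psi q - gauss_prod q (n + 0)))"
      unfolding t_def summand_telescopes[OF q] by (intro sums_mult)
    moreover have "t n summable_on UNIV"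
      using summable_on_SigmaD1[OF summable] by simp
    then have "t n sums infsum (t n) UNIV"
      by (intro has_sum_imp_sums has_sum_infsum)
    ultimately have "infsum (t n) UNIV = odd_even_ratio q n * q ^ n * (psi q - gauss_prod q n)"
      using sums_unique2 by fastforce
    also have "\<dots> = psi q * (odd_even_ratio q n * q ^ n) - q ^ n * (odd_even_ratio q n * gauss_prod q n)"
      by (simp add: algebra_simps)
    also have "q ^ n * (odd_even_ratio q n * gauss_prod q n) = (q ^ n - q * (q ^ 3) ^ n) / (1 - q)"
      unfolding odd_even_ratio_times_gauss_prod[OF q]
      by (simp add: right_diff_distrib power_mult[symmetric] power_add[symmetric] mult_ac)
    finally show ?thesis .
  qed
  have "(\<lambda>n. infsum (t n) UNIV) summable_on UNIV"
    by (rule summable_on_Sigma_banach[OF summable])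
  then have "(\<lambda>n. infsum (t n) UNIV) sums (\<Sum>\<^sub>\<infinity>n. infsum (t n) UNIV)"
    by (intro has_sum_imp_sums has_sum_infsum)
  moreover have "(\<lambda>n. infsum (t n) UNIV) sums
    (psi q * (psi q / (1 - q\<^sup>2)) - (1 / (1 - q) - q * (1 / (1 - q ^ 3))) / (1 - q))"
    unfolding row
    by (intro sums_diff sums_mult sums_divide geometric_sums sums_odd_even_ratio[OF q] q q2)
  ultimately have "(\<Sum>\<^sub>\<infinity>n. infsum (t n) UNIV)
    = psi q * (psi q / (1 - q\<^sup>2)) - (1 / (1 - q) - q * (1 / (1 - q ^ 3))) / (1 - q)"
    by (rule sums_unique2)
  also have "(1 / (1 - q) - q * (1 / (1 - q ^ 3))) / (1 - q) = (1 + q\<^sup>2) / ((1 - q) * (1 - q ^ 3))"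
  proof -
    have nz: "1 - q \<noteq> 0" "1 - q ^ 3 \<noteq> 0"
      using one_minus_nonzero[OF q] one_minus_power_nonzero[OF q, of 3] by auto
    have "1 / (1 - q) - q * (1 / (1 - q ^ 3)) = (1 - q ^ 3 - q * (1 - q)) / ((1 - q) * (1 - q ^ 3))"
      using nz by (simp add: diff_frac_eq)
    also have "1 - q ^ 3 - q * (1 - q) = (1 - q) * (1 + q\<^sup>2)" by algebra
    finally show ?thesis using nz by simp
  qed
  finally have "(\<Sum>\<^sub>\<infinity>n. infsum (t n) UNIV)
    = (psi q)\<^sup>2 / (1 - q\<^sup>2) - (1 + q\<^sup>2) / ((1 - q) * (1 - q ^ 3))"
    by (simp add: power2_eq_square)
  moreover have "(\<Sum>\<^sub>\<infinity>(k, n)\<in>UNIV. t n k) = (\<Sum>\<^sub>\<infinity>n. infsum (t n) UNIV)"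
  proof -
    have "(\<Sum>\<^sub>\<infinity>(k, n)\<in>UNIV. t n k) = (\<Sum>\<^sub>\<infinity>p\<in>prod.swap ` UNIV. case p of (n, k) \<Rightarrow> t n k)"
      by (subst infsum_reindex) (auto simp: o_def case_prod_unfold)
    also have "\<dots> = (\<Sum>\<^sub>\<infinity>n. infsum (t n) UNIV)"
      using infsum_Sigma'_banach[OF summable] by simp
    finally show ?thesis .
  qed
  ultimately show ?thesis
    unfolding t_def qpoch_quotient_eq_ratio[OF q] by simp
qed

section \<open>Coefficients of the closed form\<close>

text \<open>The slack \<open>2 * j\<close> comes from the factor \<open>1 / (1 - q\<^sup>2)\<close>: such triples correspond to the pairs
\<open>(a, b)\<close> with \<open>tri a + tri b \<le> n\<close> and \<open>tri a + tri b\<close> of the same parity as \<open>n\<close>.\<close>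

definition tri_reps :: "nat \<Rightarrow> (nat \<times> nat \<times> nat) set" where
  "tri_reps n = {(a, b, j). tri a + tri b + 2 * j = n}"

lemma finite_tri_reps: "finite (tri_reps n)"
proof (rule finite_subset)
  show "tri_reps n \<subseteq> {..n} \<times> {..n} \<times> {..n}"
    using le_tri by (fastforce simp: tri_reps_def intro: order_trans)
qed auto

text \<open>A sum of monomials over an arbitrary index set becomes a power series by collecting equal exponents.\<close>

lemma has_sum_powers_imp_sums_card:
  fixes q :: complex and d :: "'i \<Rightarrow> nat"
  assumes "((\<lambda>x. q ^ d x) has_sum S) UNIV" and fin: "\<And>n. finite {x. d x = n}"
  shows "(\<lambda>n. of_nat (card {x. d x = n}) * q ^ n) sums S"
proof (rule has_sum_imp_sums, rule has_sum_SigmaD)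
  have "bij_betw snd (SIGMA n:UNIV. {x. d x = n}) UNIV"
    by (force simp: bij_betw_def inj_on_def)
  from has_sum_reindex_bij_betw[OF this, of "\<lambda>x. q ^ d x" S] assms(1)
  have "((\<lambda>p. q ^ d (snd p)) has_sum S) (SIGMA n:UNIV. {x. d x = n})" by simp
  also have "?this \<longleftrightarrow> ((\<lambda>p. q ^ fst p) has_sum S) (SIGMA n:UNIV. {x. d x = n})"
    by (rule has_sum_cong) auto
  finally show "((\<lambda>p. q ^ fst p) has_sum S) (SIGMA n:UNIV. {x. d x = n})" .
  show "((\<lambda>x. q ^ fst (n, x)) has_sum of_nat (card {x. d x = n}) * q ^ n) {x. d x = n}" for n
    using fin by (intro has_sum_finiteI) auto
qed

lemma sums_card_tri_reps:
  assumes q: "norm q < 1"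
  shows "(\<lambda>n. of_nat (card (tri_reps n)) * q ^ n) sums ((psi q)\<^sup>2 / (1 - q\<^sup>2))"
proof -
  note sm = summable_norm_triangular_powers[OF q]
  have p: "((\<lambda>a. q ^ tri a) has_sum psi q) UNIV"
    unfolding psi_def
    by (rule norm_summable_imp_has_sum[OF sm summable_sums[OF summable_norm_cancel[OF sm]]])
  have g: "((\<lambda>j. (q\<^sup>2) ^ j) has_sum 1 / (1 - q\<^sup>2)) UNIV"
  proof (rule norm_summable_imp_has_sum)
    have q2: "norm (q\<^sup>2) < 1" using q by (simp add: norm_power_less_1)
    then show "(\<lambda>j. (q\<^sup>2) ^ j) sums (1 / (1 - q\<^sup>2))" by (rule geometric_sums)
    show "summable (\<lambda>j. norm ((q\<^sup>2) ^ j))"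
      using q2 by (simp add: norm_power[of "q\<^sup>2"] summable_geometric del: norm_power)
  qed
  have "((\<lambda>(a, b, j). q ^ (tri a + tri b + 2 * j)) has_sum (psi q)\<^sup>2 / (1 - q\<^sup>2)) UNIV"
    using has_sum_product_complex[OF p has_sum_product_complex[OF p g]]
    by (simp add: case_prod_unfold power_add power_mult power2_eq_square mult.assoc)
  then have "((\<lambda>x. q ^ (case x of (a, b, j) \<Rightarrow> tri a + tri b + 2 * j)) has_sum
    (psi q)\<^sup>2 / (1 - q\<^sup>2)) UNIV"
    by (simp add: case_prod_unfold)
  from has_sum_powers_imp_sums_card[OF this] finite_tri_reps show ?thesis
    by (simp add: tri_reps_def case_prod_unfold)
qed

text \<open>Raising \<open>n\<close> by three raises the coefficient by two, which gives a linear equation for the sum.\<close>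

lemma sums_two_thirds:
  fixes q :: complex
  assumes q: "norm q < 1"
  shows "(\<lambda>n. of_nat (2 * n div 3 + 1) * q ^ n) sums ((1 + q\<^sup>2) / ((1 - q) * (1 - q ^ 3)))"
proof -
  define h where "h n = (of_nat (2 * n div 3 + 1) :: complex)" for n
  have "summable (\<lambda>n. norm (h n * q ^ n))"
  proof (rule summable_comparison_test')
    show "summable (\<lambda>n. norm (of_nat (Suc n) * q ^ n))"
      using geometric_deriv_sums[of "norm q"] q
      by (simp add: norm_mult norm_power sums_iff del: of_nat_Suc)
    show "norm (norm (h n * q ^ n)) \<le> norm (of_nat (Suc n) * q ^ n)" for n
      unfolding h_def norm_mult norm_of_nat real_norm_def abs_mult abs_of_nat abs_norm_cancel
      by (intro mult_right_mono) auto
  qed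
  then have h: "(\<lambda>n. h n * q ^ n) sums (\<Sum>n. h n * q ^ n)"
    by (rule summable_sums[OF summable_norm_cancel])
  define H where "H = (\<Sum>n. h n * q ^ n)"
  note h = h[folded H_def]
  have "(\<lambda>n. h (n + 3) * q ^ (n + 3)) sums (H - (\<Sum>i<3. h i * q ^ i))"
    by (rule sums_split_initial_segment[OF h])
  moreover have "(\<lambda>n. q ^ 3 * (h n * q ^ n) + 2 * q ^ 3 * q ^ n) sums
    (q ^ 3 * H + 2 * q ^ 3 * (1 / (1 - q)))"
    by (intro sums_add sums_mult h geometric_sums q)
  moreover have "h (n + 3) * q ^ (n + 3) = q ^ 3 * (h n * q ^ n) + 2 * q ^ 3 * q ^ n" for n
  proof -
    have "2 * (n + 3) div 3 + 1 = 2 * n div 3 + 1 + 2" by presburger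
    then have "h (n + 3) = h n + 2" unfolding h_def by (simp only: of_nat_add of_nat_numeral)
    then show ?thesis by (simp add: algebra_simps power_add)
  qed
  ultimately have "H - (\<Sum>i<3. h i * q ^ i) = q ^ 3 * H + 2 * q ^ 3 * (1 / (1 - q))"
    by (simp only: sums_unique2)
  moreover have "{..<3} = {0, 1, 2 :: nat}" and "h 0 = 1" "h 1 = 1" "h 2 = 2"
    by (auto simp: h_def)
  ultimately have "H - (1 + q + 2 * q\<^sup>2) = q ^ 3 * H + 2 * q ^ 3 / (1 - q)"
    by (simp add: add.assoc)
  then have "(1 - q) * (H - (1 + q + 2 * q\<^sup>2)) = (1 - q) * q ^ 3 * H + 2 * q ^ 3"
    using one_minus_nonzero[OF q] by (simp add: field_simps)
  then have "H * ((1 - q) * (1 - q ^ 3)) = 1 + q\<^sup>2" by algebra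
  then have "H = (1 + q\<^sup>2) / ((1 - q) * (1 - q ^ 3))"
    using one_minus_nonzero[OF q] one_minus_power_nonzero[OF q, of 3]
    by (simp add: nonzero_eq_divide_eq)
  then show ?thesis using h by (simp add: h_def)
qed

lemma powser_coeffs_unique:
  fixes a b :: "nat \<Rightarrow> complex"
  assumes "r > 0"
    and a: "\<And>z. norm z < r \<Longrightarrow> (\<lambda>n. a n * z ^ n) sums f z"
    and b: "\<And>z. norm z < r \<Longrightarrow> (\<lambda>n. b n * z ^ n) sums f z"
  shows "a = b"
proof -
  have r2: "norm (of_real (r / 2) :: complex) < r" using assms(1) by simp
  have "0 < fps_conv_radius (Abs_fps c)"
    if "\<And>z. norm z < r \<Longrightarrow> (\<lambda>n. c n * z ^ n) sums f z" for c
  proof -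
    have "conv_radius c \<ge> norm (of_real (r / 2) :: complex)"
      using that[OF r2] by (intro conv_radius_geI sums_summable)
    then show ?thesis using assms(1)
      by (simp add: fps_conv_radius_def less_le_trans[rotated])
  qed
  note radius = this
  have "Abs_fps a = Abs_fps b"
  proof (rule eval_fps_eqD)
    have "eventually (\<lambda>z. z \<in> ball 0 r) (nhds (0 :: complex))"
      using assms(1) by (intro eventually_nhds_in_open) auto
    then show "\<forall>\<^sub>F z in nhds 0. eval_fps (Abs_fps a) z = eval_fps (Abs_fps b) z"
    proof eventually_elim
      case (elim z)
      then have "norm z < r" by simp
      from a[OF this] b[OF this] show ?case
        by (simp add: eval_fps_def sums_iff)
    qed
  qed (use radius a b in blast)+
  then show ?thesis by (simp add: fun_eq_iff Abs_fps_inject)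
qed

section \<open>Lattice points and sums of two triangular numbers\<close>

text \<open>The reflection \<open>x \<mapsto> - 1 - x\<close> preserves \<open>x * (x + 1)\<close>, so each integer has a natural number with the
same triangular number.\<close>

definition fold_nat :: "int \<Rightarrow> nat" where
  "fold_nat x = nat (if x \<ge> 0 then x else - 1 - x)"

lemma two_tri_fold_nat: "2 * int (tri (fold_nat x)) = x * (x + 1)"
proof -
  have "2 * int (tri (fold_nat x)) = int (fold_nat x) * (int (fold_nat x) + 1)"
    using two_tri[of "fold_nat x"] by (metis of_nat_1 of_nat_add of_nat_mult of_nat_numeral)
  also have "\<dots> = x * (x + 1)"
    by (auto simp: fold_nat_def algebra_simps)
  finally show ?thesis .
qed

lemma fold_nat_eq_iff: "fold_nat x = fold_nat y \<longleftrightarrow> x = y \<or> x + y = -1"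
  by (auto simp: fold_nat_def)

definition slice :: "nat \<Rightarrow> int \<Rightarrow> nat set" where
  "slice n v = {u. int u * (int u + 1) + v\<^sup>2 \<le> int n}"

lemma finite_slice: "finite (slice n v)"
proof (rule finite_subset)
  show "slice n v \<subseteq> {..n}"
  proof
    fix u assume "u \<in> slice n v"
    then have "int u * (int u + 1) \<le> int n"
      unfolding slice_def by (smt (verit) mem_Collect_eq zero_le_power2)
    moreover have "int u \<le> int u * (int u + 1)"
      by (simp add: algebra_simps)
    ultimately show "u \<in> {..n}" by simp
  qed
qed auto

text \<open>A point \<open>(u, v)\<close> is sent to the pair \<open>(u + v, u - v)\<close>, folded to natural numbers; the triangular
numbers then add up to \<open>u * (u + 1) + v\<^sup>2\<close>. The map is injective: \<open>u + v\<close> and \<open>u - v\<close> have the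
same parity, so a reflection would have to affect both coordinates, but this would make the sum
\<open>2 * u\<close> of the coordinates negative. The values \<open>v = V - 2 i\<close> for \<open>i \<le> V\<close> are the integers of absolute
value at most \<open>V\<close> and of the parity of \<open>V\<close>.\<close>

lemma sum_card_slice_le_card_tri_reps:
  assumes "even (n + V)"
  shows "(\<Sum>i\<le>V. card (slice n (int V - 2 * int i))) \<le> card (tri_reps n)"
proof -
  define L where "L = (SIGMA i:{..V}. slice n (int V - 2 * int i))"
  define f where "f = (\<lambda>(i, u).
    let a = fold_nat (int u + (int V - 2 * int i)); b = fold_nat (int u - (int V - 2 * int i))
    in (a, b, (n - tri a - tri b) div 2))"
  have "inj_on f L"
  proof (rule inj_onI, clarify)
    fix i u i' u'
    assume "f (i, u) = f (i', u')"
    then have "fold_nat (int u + (int V - 2 * int i)) = fold_nat (int u' + (int V - 2 * int i'))"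
      and "fold_nat (int u - (int V - 2 * int i)) = fold_nat (int u' - (int V - 2 * int i'))"
      by (auto simp: f_def Let_def)
    then show "i = i' \<and> u = u'"
      unfolding fold_nat_eq_iff
    proof (elim disjE)
      assume "int u + (int V - 2 * int i) = int u' + (int V - 2 * int i')"
        "int u - (int V - 2 * int i) + (int u' - (int V - 2 * int i')) = - 1"
      then have "2 * (int u' + 2 * int i - int V) = - 1" by algebra
      then show ?thesis by presburger
    next
      assume "int u + (int V - 2 * int i) + (int u' + (int V - 2 * int i')) = - 1"
        "int u - (int V - 2 * int i) = int u' - (int V - 2 * int i')"
      then have "2 * (int u' + int V - 2 * int i) = - 1" by algebra
      then show ?thesis by presburger
    qed linarith+
  qed
  moreover have "f ` L \<subseteq> tri_reps n"
  proof (clarify)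
    fix a b j i u
    assume iu: "(i, u) \<in> L" and f: "(a, b, j) = f (i, u)"
    define v where "v = int V - 2 * int i"
    have ab: "a = fold_nat (int u + v)" "b = fold_nat (int u - v)"
      "j = (n - tri a - tri b) div 2"
      using f by (auto simp: f_def Let_def v_def)
    have "2 * (int (tri a) + int (tri b)) = 2 * (int u * (int u + 1) + v\<^sup>2)"
      using two_tri_fold_nat[of "int u + v"] two_tri_fold_nat[of "int u - v"]
      unfolding ab by (simp add: algebra_simps power2_eq_square)
    then have s: "int (tri a) + int (tri b) = int u * (int u + 1) + v\<^sup>2" by simp
    have "even (int u * (int u + 1) + v\<^sup>2 + int V)"
      by (auto simp: v_def)
    then have "even (tri a + tri b + V)"
      unfolding s[symmetric] by (metis even_of_nat of_nat_add)
    then have "even (n - (tri a + tri b))" "tri a + tri b \<le> n"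
      using assms s iu by (auto simp: L_def slice_def v_def)
    then show "(a, b, j) \<in> tri_reps n"
      by (auto simp: tri_reps_def ab(3) elim!: evenE)
  qed
  ultimately have "card L \<le> card (tri_reps n)"
    using card_inj_on_le finite_tri_reps by blast
  then show ?thesis
    by (simp add: L_def card_SigmaI finite_slice)
qed

text \<open>The simpler minorant \<open>1 - t\<close> would give exactly \<open>2/3\<close> as the leading constant of the final estimate
and leave no room for the error term. Keeping the value and slope at \<open>t = 0\<close> and the zero at \<open>t = 1\<close>
raises the constant to \<open>11/15\<close>.\<close>

lemma sqrt_one_minus_ge:
  fixes t :: real
  assumes "0 \<le> t" "t \<le> 1"
  shows "1 - t / 2 - t\<^sup>2 / 2 \<le> sqrt (1 - t)"
proof (rule real_le_rsqrt)
  have "1 - t - (1 - t / 2 - t\<^sup>2 / 2)\<^sup>2 = (1 - t) * t\<^sup>2 * (3 + t) / 4"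
    by (simp add: field_simps power2_eq_square)
  also have "\<dots> \<ge> 0" using assms by simp
  finally show "(1 - t / 2 - t\<^sup>2 / 2)\<^sup>2 \<le> 1 - t" by simp
qed

text \<open>The slice contains all \<open>u\<close> with \<open>u + 1 / 2 \<le> sqrt (n - v\<^sup>2)\<close>, and rounding costs at most \<open>1 / 2\<close>.
The bound is then made polynomial in \<open>v\<close>, so that the sum over \<open>v\<close> can be evaluated.\<close>

lemma card_slice_ge:
  fixes v :: int
  assumes "n > 0" "v\<^sup>2 \<le> int n"
  shows "(real n - of_int v ^ 2 / 2 - of_int v ^ 4 / (2 * real n)) / sqrt (real n) - 1 / 2
    \<le> real (card (slice n v))"
proof -
  define x where "x = real n - of_int v ^ 2"
  define c where "c = nat \<lfloor>sqrt x + 1 / 2\<rfloor>"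
  define t where "t = of_int v ^ 2 / real n"
  have vn: "real_of_int v ^ 2 \<le> real n"
    using assms(2) by (metis of_int_le_iff of_int_of_nat_eq of_int_power)
  then have x0: "x \<ge> 0" by (simp add: x_def)
  have t: "0 \<le> t" "t \<le> 1" using vn assms by (auto simp: t_def)
  have "(real n - of_int v ^ 2 / 2 - of_int v ^ 4 / (2 * real n)) / sqrt (real n)
      = sqrt n * (1 - t / 2 - t\<^sup>2 / 2)"
  proof -
    have "real n = sqrt n * sqrt n" by simp
    then show ?thesis using assms
      by (simp add: t_def divide_simps) (simp add: algebra_simps power2_eq_square power4_eq_xxxx)
  qed
  also have "\<dots> \<le> sqrt n * sqrt (1 - t)"
    using sqrt_one_minus_ge[OF t] by (intro mult_left_mono) auto
  also have "\<dots> = sqrt x"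
    using assms by (simp add: real_sqrt_mult[symmetric] t_def x_def field_simps)
  finally have 1: "(real n - of_int v ^ 2 / 2 - of_int v ^ 4 / (2 * real n)) / sqrt (real n)
    \<le> sqrt x" .
  have "{..<c} \<subseteq> slice n v"
  proof
    fix u assume "u \<in> {..<c}"
    then have "real u + 1 \<le> sqrt x + 1 / 2"
      unfolding c_def by (simp, linarith)
    then have "(real u + 1 / 2)\<^sup>2 \<le> (sqrt x)\<^sup>2"
      by (intro power_mono) auto
    then have "real u * (real u + 1) + of_int v ^ 2 \<le> real n"
      using x0 by (simp add: x_def power2_eq_square field_simps)
    then have "real_of_int (int u * (int u + 1) + v\<^sup>2) \<le> real_of_int (int n)"
      by simp
    then show "u \<in> slice n v"
      unfolding slice_def of_int_le_iff by simp
  qed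
  from card_mono[OF finite_slice this] have "c \<le> card (slice n v)"
    by simp
  moreover have "sqrt x - 1 / 2 \<le> real c"
    unfolding c_def using real_sqrt_ge_zero[OF x0] by linarith
  ultimately show ?thesis using 1 by linarith
qed

text \<open>The induction needs \<open>V\<close> inside the summand to be independent of the number of summands.\<close>

lemma sum_squares_step_two:
  "(\<Sum>i\<le>V. (real V - 2 * real i) ^ 2) = real V * (real V + 1) * (real V + 2) / 3"
proof -
  have "(\<Sum>i\<le>m. (x - 2 * real i) ^ 2) =
    (real m + 1) * (x\<^sup>2 - 2 * x * real m + 2 * real m * (2 * real m + 1) / 3)" for x m
    by (induction m) (simp_all add: field_simps power2_eq_square)
  from this[of "real V" V] show ?thesis by (simp add: field_simps power2_eq_square)
qed

lemma sum_fourth_powers_step_two: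
  "(\<Sum>i\<le>V. (real V - 2 * real i) ^ 4)
    = real V * (real V + 1) * (real V + 2) * (3 * real V ^ 2 + 6 * real V - 4) / 15"
proof -
  have "(\<Sum>i\<le>m. (x - 2 * real i) ^ 4) =
    (real m + 1) * (x^4 - 4 * x^3 * real m + 4 * x\<^sup>2 * real m * (2 * real m + 1)
      - 8 * x * real m ^ 2 * (real m + 1)
      + 8 * real m * (2 * real m + 1) * (3 * real m ^ 2 + 3 * real m - 1) / 15)" for x m
    by (induction m) (simp_all add: field_simps power2_eq_square power3_eq_cube power4_eq_xxxx)
  from this[of "real V" V] show ?thesis
    by (simp add: field_simps power2_eq_square power3_eq_cube power4_eq_xxxx)
qed

text \<open>Here \<open>R\<close> is the square root of \<open>n\<close> and \<open>L\<close> is the number of slices. With \<open>L = R + d\<close>, the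
difference of the two sides multiplied by \<open>30 * R ^ 3\<close> is \<open>2 * R ^ 5 - 15 * R ^ 4\<close> plus terms of degree at
most three in \<open>R\<close>.\<close>

lemma slice_bound_polynomial:
  fixes R L :: real
  assumes R: "R \<ge> 10" and L: "R - 1 \<le> L" "L \<le> R + 1"
  shows "2 * R\<^sup>2 / 3 < (L * R\<^sup>2 - L * (L\<^sup>2 - 1) / 6 - L * (L\<^sup>2 - 1) * (3 * L\<^sup>2 - 7) / (30 * R\<^sup>2)) / R
    - L / 2"
proof -
  define d where "d = L - R"
  have d: "\<bar>d\<bar> \<le> 1" using L by (auto simp: d_def)
  \<comment> \<open>expansion in powers of \<open>R\<close> at \<open>L = R + d\<close>; each bracket is then bounded using \<open>\<bar>d\<bar> \<le> 1\<close>\<close>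
  have "30 * L * R^4 - 5 * L * (L\<^sup>2 - 1) * R\<^sup>2 - L * (L\<^sup>2 - 1) * (3 * L\<^sup>2 - 7)
      - 15 * L * R^3 - 20 * R^5
    = R^3 * (2 * R\<^sup>2 - 15 * R - 45) + R^3 * (60 - 45 * d\<^sup>2 - 15 * d) + 35 * R\<^sup>2 * (d - d^3)
      + R * (30 * d\<^sup>2 - 15 * d^4 - 7) + (10 * d^3 - 3 * d^5 - 7 * d)"
  proof -
    have "L = R + d" by (simp add: d_def)
    then show ?thesis by (simp add: algebra_simps eval_nat_numeral)
  qed
  moreover have "5 * R^3 \<le> R^3 * (2 * R\<^sup>2 - 15 * R - 45)"
  proof -
    have "10 * R \<le> R\<^sup>2" using R by (simp add: power2_eq_square)
    then have "5 \<le> 2 * R\<^sup>2 - 15 * R - 45" using R by linarith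
    then have "R^3 * 5 \<le> R^3 * (2 * R\<^sup>2 - 15 * R - 45)" using R by (intro mult_left_mono) auto
    then show ?thesis by simp
  qed
  moreover have d1: "\<bar>d ^ k\<bar> \<le> 1" for k
    using d by (simp add: power_abs power_le_one)
  have "0 \<le> R^3 * (60 - 45 * d\<^sup>2 - 15 * d)"
    using R d d1[of 2] by (intro mult_nonneg_nonneg) auto
  moreover have "35 * R\<^sup>2 * (-1) \<le> 35 * R\<^sup>2 * (d - d^3)"
  proof (intro mult_left_mono)
    have "d - d^3 = d * (1 - d\<^sup>2)" by algebra
    moreover have "\<bar>d * (1 - d\<^sup>2)\<bar> \<le> 1 * 1"
      unfolding abs_mult using d d1[of 2] by (intro mult_mono) auto
    ultimately show "- 1 \<le> d - d^3" by linarith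
  qed auto
  moreover have "R * (- 22) \<le> R * (30 * d\<^sup>2 - 15 * d^4 - 7)"
    using R d1[of 4] zero_le_power2[of d] by (intro mult_left_mono) linarith+
  moreover have "- 20 \<le> 10 * d^3 - 3 * d^5 - 7 * d"
    using d d1[of 3] d1[of 5] by linarith
  moreover have "50 * R\<^sup>2 \<le> 5 * R^3" "10 * R \<le> R\<^sup>2"
    using R by (simp_all add: power2_eq_square power3_eq_cube)
  ultimately have "0 < 30 * L * R^4 - 5 * L * (L\<^sup>2 - 1) * R\<^sup>2 - L * (L\<^sup>2 - 1) * (3 * L\<^sup>2 - 7)
    - 15 * L * R^3 - 20 * R^5"
    using R by linarith
  then have "0 < (30 * L * R^4 - 5 * L * (L\<^sup>2 - 1) * R\<^sup>2 - L * (L\<^sup>2 - 1) * (3 * L\<^sup>2 - 7)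
    - 15 * L * R^3 - 20 * R^5) / (30 * R^3)"
    using R by simp
  also have "\<dots> = ((L * R\<^sup>2 - L * (L\<^sup>2 - 1) / 6 - L * (L\<^sup>2 - 1) * (3 * L\<^sup>2 - 7) / (30 * R\<^sup>2)) / R
    - L / 2) - 2 * R\<^sup>2 / 3"
    using R by (simp add: field_simps power2_eq_square power3_eq_cube power4_eq_xxxx eval_nat_numeral)
  finally show ?thesis by simp
qed

lemma card_tri_reps_gt_large:
  assumes "n \<ge> 100"
  shows "2 * real n / 3 < real (card (tri_reps n))"
proof -
  define R where "R = sqrt (real n)"
  have R2: "R\<^sup>2 = real n" by (simp add: R_def)
  have R10: "R \<ge> 10" unfolding R_def by (rule real_le_rsqrt) (use assms in simp)
  define s where "s = nat \<lfloor>R\<rfloor>"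
  \<comment> \<open>the largest integer up to \<open>R\<close> with the parity of \<open>n\<close>\<close>
  define V where "V = (if even (n + s) then s else s - 1)"
  have s: "real s \<le> R" "R < real s + 1" "s \<ge> 10"
    using R10 unfolding s_def by linarith+
  have par: "even (n + V)" using s(3) by (auto simp: V_def)
  have V: "real V \<le> R" "R - 2 \<le> real V"
    using s by (auto simp: V_def of_nat_diff)
  define L where "L = real V + 1"
  have "2 * real n / 3 = 2 * R\<^sup>2 / 3" by (simp add: R2)
  also have "\<dots> < (L * R\<^sup>2 - L * (L\<^sup>2 - 1) / 6 - L * (L\<^sup>2 - 1) * (3 * L\<^sup>2 - 7) / (30 * R\<^sup>2)) / R
    - L / 2"
    using slice_bound_polynomial[OF R10, of L] V by (simp add: L_def)
  also have "\<dots> = (\<Sum>i\<le>V. (real n - (real V - 2 * real i) ^ 2 / 2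
      - (real V - 2 * real i) ^ 4 / (2 * real n)) / R - 1 / 2)"
  proof -
    \<comment> \<open>\<open>V * (V + 2) = L\<^sup>2 - 1\<close> brings the power sums into the form of the polynomial bound\<close>
    have "(\<Sum>i\<le>V. (real n - (real V - 2 * real i) ^ 2 / 2
      - (real V - 2 * real i) ^ 4 / (2 * real n)) / R - 1 / 2)
      = (L * real n - (\<Sum>i\<le>V. (real V - 2 * real i) ^ 2) / 2
        - (\<Sum>i\<le>V. (real V - 2 * real i) ^ 4) / (2 * real n)) / R - L / 2"
      by (simp add: sum_subtractf sum.distrib sum_divide_distrib[symmetric] L_def algebra_simps)
    also have "\<dots> = (L * R\<^sup>2 - L * (L\<^sup>2 - 1) / 6
      - L * (L\<^sup>2 - 1) * (3 * L\<^sup>2 - 7) / (30 * R\<^sup>2)) / R - L / 2"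
    proof -
      have "real V * (real V + 1) * (real V + 2) = L * (L\<^sup>2 - 1)"
        "3 * real V ^ 2 + 6 * real V - 4 = 3 * L\<^sup>2 - 7"
        by (simp_all add: L_def power2_eq_square algebra_simps)
      then show ?thesis
        unfolding sum_squares_step_two sum_fourth_powers_step_two R2 by simp
    qed
    finally show ?thesis by simp
  qed
  also have "\<dots> \<le> (\<Sum>i\<le>V. real (card (slice n (int V - 2 * int i))))"
  proof (rule sum_mono)
    fix i assume i: "i \<in> {..V}"
    have "(real V - 2 * real i)\<^sup>2 \<le> R\<^sup>2"
      using i V by (intro abs_le_square_iff[THEN iffD1]) auto
    then have "real_of_int ((int V - 2 * int i)\<^sup>2) \<le> real_of_int (int n)"
      by (simp add: R2)
    then have "(int V - 2 * int i)\<^sup>2 \<le> int n" by (simp only: of_int_le_iff)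
    from card_slice_ge[OF _ this] assms
    show "(real n - (real V - 2 * real i) ^ 2 / 2
      - (real V - 2 * real i) ^ 4 / (2 * real n)) / R - 1 / 2
      \<le> real (card (slice n (int V - 2 * int i)))"
      by (simp add: R_def)
  qed
  also have "\<dots> \<le> real (card (tri_reps n))"
    using sum_card_slice_le_card_tri_reps[OF par] by (metis of_nat_le_iff of_nat_sum)
  finally show ?thesis .
qed

section \<open>Small cases and positivity\<close>

text \<open>An executable form of the size of a slice. For \<open>n < 100\<close> no point is lost, because
\<open>u * (u + 1) < 100\<close> forces \<open>u \<le> 9\<close>.\<close>

definition slice_size :: "int \<Rightarrow> int \<Rightarrow> nat" where
  "slice_size n v = length (filter (\<lambda>u. u * (u + 1) + v * v \<le> n) [0, 1, 2, 3, 4, 5, 6, 7, 8, 9])"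

lemma slice_size_le: "slice_size (int n) v \<le> card (slice n v)"
proof -
  define A where "A = set (filter (\<lambda>u. u * (u + 1) + v * v \<le> int n) [0, 1, 2, 3, 4, 5, 6, 7, 8, 9])"
  have "slice_size (int n) v = card A"
    unfolding slice_size_def A_def by (rule distinct_card[symmetric]) (rule distinct_filter, simp)
  also have "\<dots> = card (nat ` A)"
    by (rule card_image[symmetric]) (auto simp: A_def inj_on_def)
  also have "\<dots> \<le> card (slice n v)"
    by (rule card_mono[OF finite_slice]) (auto simp: A_def slice_def power2_eq_square)
  finally show ?thesis .
qed

lemma sum_slice_size_gt_small:
  "\<forall>n \<in> set [0..99]. 2 * n < 3 * int (sum_list (map (slice_size n)
     (if even n then [8, 6, 4, 2, 0, -2, -4, -6, -8] else [9, 7, 5, 3, 1, -1, -3, -5, -7, -9])))"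
  by code_simp

lemma card_tri_reps_gt_small:
  assumes "n < 100"
  shows "2 * n < 3 * card (tri_reps n)"
proof -
  \<comment> \<open>the largest integer of the parity of \<open>n\<close> whose square is below 100\<close>
  define V :: nat where "V = (if even n then 8 else 9)"
  have "int n \<in> set [0..99]" using assms by simp
  from bspec[OF sum_slice_size_gt_small this]
  have "2 * int n < 3 * int (\<Sum>i\<le>V. slice_size (int n) (int V - 2 * int i))"
    by (cases "even n") (simp_all add: V_def eval_nat_numeral)
  also have "\<dots> \<le> 3 * int (\<Sum>i\<le>V. card (slice n (int V - 2 * int i)))"
    by (simp only: of_nat_le_iff mult_le_cancel_left_pos zero_less_numeral)
      (intro sum_mono slice_size_le)
  also have "\<dots> \<le> 3 * int (card (tri_reps n))"
  proof -
    have "even (n + V)" by (simp add: V_def)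
    from sum_card_slice_le_card_tri_reps[OF this] show ?thesis by linarith
  qed
  finally show ?thesis by simp
qed

text \<open>By integrality this is the bound \<open>\<lfloor>2 n / 3\<rfloor> + 1 \<le> card (tri_reps n)\<close> that the coefficients call for.\<close>

theorem card_tri_reps_gt: "2 * n < 3 * card (tri_reps n)"
proof (cases "n < 100")
  case False
  then have "2 * real n / 3 < real (card (tri_reps n))"
    by (intro card_tri_reps_gt_large) simp
  then have "real (2 * n) < real (3 * card (tri_reps n))" by simp
  then show ?thesis by (simp only: of_nat_less_iff)
qed (rule card_tri_reps_gt_small)

theorem corollary2p3:
  fixes F1 :: "nat \<Rightarrow> complex"
  assumes F1: "\<And>q :: complex. norm q < 1 \<Longrightarrow>
    (\<lambda>n. F1 n * q ^ n) sums
      (\<Sum>\<^sub>\<infinity>(k, n)\<in>(UNIV :: (nat \<times> nat) set).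
         qpoch (q ^ (2 * n + 2)) (q ^ 2) k / qpoch (q ^ (2 * n + 3)) (q ^ 2) k
           * q ^ (2 * k + 3 * n + 1))"
  shows "nonneg_series F1"
proof -
  have "F1 = (\<lambda>n. of_nat (card (tri_reps n)) - of_nat (2 * n div 3 + 1))"
  proof (rule powser_coeffs_unique[OF zero_less_one F1])
    fix q :: complex assume q: "norm q < 1"
    show "(\<lambda>n. (of_nat (card (tri_reps n)) - of_nat (2 * n div 3 + 1)) * q ^ n) sums
      (\<Sum>\<^sub>\<infinity>(k, n)\<in>(UNIV :: (nat \<times> nat) set).
         qpoch (q ^ (2 * n + 2)) (q ^ 2) k / qpoch (q ^ (2 * n + 3)) (q ^ 2) k
           * q ^ (2 * k + 3 * n + 1))"
    proof -
      have "(\<lambda>n. of_nat (card (tri_reps n)) * q ^ n - of_nat (2 * n div 3 + 1) * q ^ n) sums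
        ((psi q)\<^sup>2 / (1 - q\<^sup>2) - (1 + q\<^sup>2) / ((1 - q) * (1 - q ^ 3)))"
        by (intro sums_diff sums_card_tri_reps sums_two_thirds q)
      moreover have "(of_nat (card (tri_reps n)) - of_nat (2 * n div 3 + 1)) * q ^ n
        = of_nat (card (tri_reps n)) * q ^ n - of_nat (2 * n div 3 + 1) * q ^ n" for n
        by (rule left_diff_distrib)
      ultimately show ?thesis by (simp only: double_sum_eq[OF q])
    qed
  qed
  moreover have "2 * n div 3 + 1 \<le> card (tri_reps n)" for n
    using card_tri_reps_gt[of n] by linarith
  ultimately have "F1 n = of_nat (card (tri_reps n) - (2 * n div 3 + 1))" for n
    by (simp only: of_nat_diff)
  then show ?thesis by (simp add: nonneg_series_def)
qed

end
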